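(* Let $G_1$ and $G_2$ be looped simple graphs and $v\in V(G_1)$. The following are equivalent: (1) up to isomorphism, $G_2$ is obtained from $G_1$ by complementing the loop status of $v$; (2) there is a compatible isomorphism $\beta:M(IAS(G_1))\to M(IAS(G_2))$ with $f_\beta(v)=(\chi\psi)$ and $f_\beta(w)=1$ for all $w\neq v$.
   Context: A looped simple graph is a finite graph in which each vertex may carry at most one loop and distinct non-loop edges join distinct pairs of vertices. $A(G)$ is its adjacency matrix over $GF(2)$ (diagonal entry $1$ iff looped). $M(IAS(G))$ is the binary matroid represented by the columns of $(I\mid A(G)\mid I+A(G))$ over $GF(2)$; its ground set $W(G)$ consists of columns $v_\phi,v_\chi,v_\psi$, the columns of $v$ in $I$, $A(G)$, $I+A(G)$. $S_3$ is the permutation group of $\{\phi,\chi,\psi\}$ with identity $1$ and standard cycle notation. A compatible isomorphism $\beta$ is a matroid isomorphism mapping each cell $\{v_\phi,v_\chi,v_\psi\}$ onto some cell $\{w_\phi,w_\chi,w_\psi\}$; it induces a bijection $\beta:V(G_1)\to V(G_2)$ and $f_\beta:V(G_1)\to S_3$ with $\beta(v_\iota)=\beta(v)_{f_\beta(v)(\iota)}$. *)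

theory Defs
  imports
    Complex_Main
    "HOL-Library.Z2"
    "HOL-Library.Function_Algebras"
    "HOL-Combinatorics.Transposition"
begin

section \<open>Looped simple graphs\<close>

text \<open>Edges are sets of vertices: a non-loop edge is a two-element set, and a loop at
  \<open>v\<close> is the singleton \<open>{v}\<close>. Hence there are no parallel edges and no repeated loops.\<close>

record 'a lgraph =
  verts :: "'a set"
  edges :: "'a set set"

definition looped_simple_graph :: "'a lgraph \<Rightarrow> bool" where
  "looped_simple_graph G \<longleftrightarrow>
     finite (verts G) \<and> (\<forall>e \<in> edges G. e \<subseteq> verts G \<and> (card e = 1 \<or> card e = 2))"

definition graph_isomorphic :: "'a lgraph \<Rightarrow> 'b lgraph \<Rightarrow> bool" where
  "graph_isomorphic G H \<longleftrightarrow>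
     (\<exists>f. bij_betw f (verts G) (verts H) \<and>
          (\<forall>u \<in> verts G. \<forall>w \<in> verts G. {u, w} \<in> edges G \<longleftrightarrow> {f u, f w} \<in> edges H))"

definition complement_loop :: "'a lgraph \<Rightarrow> 'a \<Rightarrow> 'a lgraph" where
  "complement_loop G v =
     G\<lparr>edges := (if {v} \<in> edges G then edges G - {{v}} else insert {v} (edges G))\<rparr>"

text \<open>For \<open>u = w\<close> the set \<open>{u, w}\<close> is the loop at \<open>u\<close>.\<close>

definition adj_matrix :: "'a lgraph \<Rightarrow> 'a \<Rightarrow> 'a \<Rightarrow> bit" where
  "adj_matrix G u w = (if {u, w} \<in> edges G then 1 else 0)"


section \<open>Binary matroids\<close>

record 'e matroid =
  ground :: "'e set"
  indep :: "'e set \<Rightarrow> bool"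

definition is_matroid :: "'e matroid \<Rightarrow> bool" where
  "is_matroid M \<longleftrightarrow>
     finite (ground M) \<and>
     (\<forall>S. indep M S \<longrightarrow> S \<subseteq> ground M) \<and>
     indep M {} \<and>
     (\<forall>S T. indep M T \<longrightarrow> S \<subseteq> T \<longrightarrow> indep M S) \<and>
     (\<forall>S T. indep M S \<longrightarrow> indep M T \<longrightarrow> card S < card T \<longrightarrow>
        (\<exists>x \<in> T - S. indep M (insert x S)))"

definition matroid_isomorphism :: "'e matroid \<Rightarrow> 'f matroid \<Rightarrow> ('e \<Rightarrow> 'f) \<Rightarrow> bool" where
  "matroid_isomorphism M N \<beta> \<longleftrightarrow>
     bij_betw \<beta> (ground M) (ground N) \<and>
     (\<forall>S \<subseteq> ground M. indep M S \<longleftrightarrow> indep N (\<beta> ` S))"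

definition gf2_scale :: "bit \<Rightarrow> ('r \<Rightarrow> bit) \<Rightarrow> 'r \<Rightarrow> bit" where
  "gf2_scale c x = (\<lambda>i. c * x i)"

interpretation gf2: vector_space gf2_scale
  by unfold_locales
    (auto simp: gf2_scale_def fun_eq_iff distrib_left distrib_right mult.assoc)

text \<open>A vector indexed by the row set \<open>R\<close> is extended by zero outside \<open>R\<close>.\<close>

definition matrix_column :: "'r set \<Rightarrow> ('r \<Rightarrow> 'c \<Rightarrow> bit) \<Rightarrow> 'c \<Rightarrow> 'r \<Rightarrow> bit" where
  "matrix_column R A j = (\<lambda>i. if i \<in> R then A i j else 0)"

text \<open>The matroid elements are the column indices, so equal columns with different indices
  are distinct (parallel) elements; the injectivity condition makes independence that of a
  family of columns rather than of the set of its values.\<close>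

definition column_matroid :: "'r set \<Rightarrow> 'c set \<Rightarrow> ('r \<Rightarrow> 'c \<Rightarrow> bit) \<Rightarrow> 'c matroid" where
  "column_matroid R C A =
     \<lparr>ground = C,
      indep = (\<lambda>S. S \<subseteq> C \<and> inj_on (matrix_column R A) S \<and>
                   gf2.independent (matrix_column R A ` S))\<rparr>"

lemma is_matroid_column_matroid:
  assumes "finite C"
  shows "is_matroid (column_matroid R C A)"
proof -
  let ?c = "matrix_column R A"
  let ?I = "\<lambda>S. S \<subseteq> C \<and> inj_on ?c S \<and> gf2.independent (?c ` S)"
  have sub: "?I S" if "?I T" "S \<subseteq> T" for S T
    using that by (meson gf2.independent_mono image_mono inj_on_subset subset_trans)
  have aug: "\<exists>x \<in> T - S. ?I (insert x S)"
    if S: "?I S" and T: "?I T" and lt: "card S < card T" for S T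
  proof -
    have fin: "finite S" using S assms finite_subset by blast
    have "\<not> ?c ` T \<subseteq> gf2.span (?c ` S)"
    proof
      assume "?c ` T \<subseteq> gf2.span (?c ` S)"
      then have "card (?c ` T) \<le> card (?c ` S)"
        using gf2.independent_span_bound fin T by blast
      then show False using S T lt by (simp add: card_image)
    qed
    then obtain x where x: "x \<in> T" "?c x \<notin> gf2.span (?c ` S)" by blast
    then have notin: "?c x \<notin> ?c ` S" using gf2.span_base by blast
    have "?I (insert x S)"
      using S T x notin by (auto simp: gf2.independent_insert)
    then show ?thesis using x notin by blast
  qed
  have ground: "ground (column_matroid R C A) = C"
    and indep: "indep (column_matroid R C A) = ?I"
    by (simp_all add: column_matroid_def)
  show ?thesis
    unfolding is_matroid_def ground indep
  proof (intro conjI)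
    show "finite C" by (fact assms)
    show "\<forall>S. ?I S \<longrightarrow> S \<subseteq> C" by blast
    show "{} \<subseteq> C" "inj_on ?c {}" "gf2.independent (?c ` {})"
      by (simp_all add: gf2.independent_empty)
    show "\<forall>S T. ?I T \<longrightarrow> S \<subseteq> T \<longrightarrow> ?I S" using sub by blast
    show "\<forall>S T. ?I S \<longrightarrow> ?I T \<longrightarrow> card S < card T \<longrightarrow> (\<exists>x \<in> T - S. ?I (insert x S))"
      using aug by blast
  qed
qed


section \<open>The isotropic matroid\<close>

datatype label = Phi | Chi | Psi

text \<open>The column \<open>(v, \<iota>)\<close> of the matrix \<open>(I | A(G) | I + A(G))\<close> is the element written
  \<open>v\<close> with subscript \<open>\<iota>\<close>.\<close>

definition IAS_matrix :: "'a lgraph \<Rightarrow> 'a \<Rightarrow> 'a \<times> label \<Rightarrow> bit" where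
  "IAS_matrix G u = (\<lambda>(v, \<iota>).
     let I = (if u = v then 1 else 0) in
     case \<iota> of
       Phi \<Rightarrow> I
     | Chi \<Rightarrow> adj_matrix G u v
     | Psi \<Rightarrow> I + adj_matrix G u v)"

definition IAS_matroid :: "'a lgraph \<Rightarrow> ('a \<times> label) matroid" where
  "IAS_matroid G = column_matroid (verts G) (verts G \<times> UNIV) (IAS_matrix G)"

definition cell :: "'a \<Rightarrow> ('a \<times> label) set" where
  "cell v = {v} \<times> UNIV"

definition compatible_isomorphism ::
    "'a lgraph \<Rightarrow> 'b lgraph \<Rightarrow> ('a \<times> label \<Rightarrow> 'b \<times> label) \<Rightarrow> bool" where
  "compatible_isomorphism G H \<beta> \<longleftrightarrow>
     matroid_isomorphism (IAS_matroid G) (IAS_matroid H) \<beta> \<and>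
     (\<forall>v \<in> verts G. \<exists>w \<in> verts H. \<beta> ` cell v = cell w)"

text \<open>The vertex bijection and the permutations \<open>f\<^sub>\<beta>(v)\<close> induced by a compatible
  isomorphism. Reading the vertex off the image of the \<open>Phi\<close>-element is no real choice,
  since \<open>\<beta>\<close> maps cells onto cells; see the lemmas below.\<close>

definition induced_vertex :: "('a \<times> label \<Rightarrow> 'b \<times> label) \<Rightarrow> 'a \<Rightarrow> 'b" where
  "induced_vertex \<beta> v = fst (\<beta> (v, Phi))"

definition induced_perm :: "('a \<times> label \<Rightarrow> 'b \<times> label) \<Rightarrow> 'a \<Rightarrow> label \<Rightarrow> label" where
  "induced_perm \<beta> v = (\<lambda>\<iota>. snd (\<beta> (v, \<iota>)))"

lemma compatible_isomorphism_apply: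
  assumes "compatible_isomorphism G H \<beta>" and "v \<in> verts G"
  shows "\<beta> (v, \<iota>) = (induced_vertex \<beta> v, induced_perm \<beta> v \<iota>)"
proof -
  obtain w where w: "\<beta> ` cell v = cell w"
    using assms by (auto simp: compatible_isomorphism_def)
  have "fst (\<beta> (v, \<kappa>)) = w" for \<kappa>
  proof -
    have "\<beta> (v, \<kappa>) \<in> cell w" unfolding w[symmetric] by (auto simp: cell_def)
    then show ?thesis by (auto simp: cell_def)
  qed
  then show ?thesis by (simp add: induced_vertex_def induced_perm_def prod_eq_iff)
qed

lemma bij_induced_perm:
  assumes "compatible_isomorphism G H \<beta>" and "v \<in> verts G"
  shows "bij (induced_perm \<beta> v)"
proof -
  have inj: "inj_on \<beta> (verts G \<times> UNIV)"
    using assms by (auto simp: compatible_isomorphism_def matroid_isomorphism_def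
        IAS_matroid_def column_matroid_def bij_betw_def)
  have "inj (induced_perm \<beta> v)"
  proof (rule injI)
    fix \<iota> \<kappa> assume "induced_perm \<beta> v \<iota> = induced_perm \<beta> v \<kappa>"
    then have "\<beta> (v, \<iota>) = \<beta> (v, \<kappa>)"
      by (simp add: compatible_isomorphism_apply[OF assms])
    then show "\<iota> = \<kappa>" using inj assms(2) by (auto dest: inj_onD)
  qed
  moreover have "finite (UNIV :: label set)"
  proof -
    have "(UNIV :: label set) = {Phi, Chi, Psi}" using label.exhaust by auto
    then show ?thesis by (metis finite.emptyI finite.insertI)
  qed
  ultimately show ?thesis by (simp add: bij_def finite_UNIV_inj_surj)
qed

lemma bij_betw_induced_vertex:
  assumes "compatible_isomorphism G H \<beta>"
  shows "bij_betw (induced_vertex \<beta>) (verts G) (verts H)"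
proof -
  have bij: "bij_betw \<beta> (verts G \<times> UNIV) (verts H \<times> UNIV)"
    using assms by (auto simp: compatible_isomorphism_def matroid_isomorphism_def
        IAS_matroid_def column_matroid_def)
  note app = compatible_isomorphism_apply[OF assms]
  have "inj_on (induced_vertex \<beta>) (verts G)"
  proof (rule inj_onI)
    fix u v assume uv: "u \<in> verts G" "v \<in> verts G"
      and eq: "induced_vertex \<beta> u = induced_vertex \<beta> v"
    obtain \<kappa> where "induced_perm \<beta> v \<kappa> = induced_perm \<beta> u Phi"
      using bij_induced_perm[OF assms uv(2)] by (metis bij_pointE)
    then have "\<beta> (u, Phi) = \<beta> (v, \<kappa>)" using app uv eq by simp
    then show "u = v" using bij uv by (auto simp: bij_betw_def dest: inj_onD)
  qed
  moreover have "induced_vertex \<beta> ` verts G = verts H"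
  proof
    show "induced_vertex \<beta> ` verts G \<subseteq> verts H"
      using bij_betw_apply[OF bij] by (fastforce simp: induced_vertex_def mem_Times_iff)
    show "verts H \<subseteq> induced_vertex \<beta> ` verts G"
    proof
      fix w assume "w \<in> verts H"
      then have "(w, Phi) \<in> \<beta> ` (verts G \<times> UNIV)" using bij by (auto simp: bij_betw_def)
      then show "w \<in> induced_vertex \<beta> ` verts G" using app by fastforce
    qed
  qed
  ultimately show ?thesis by (simp add: bij_betw_def)
qed

end

theory Submission
  imports Defs
begin

text \<open>Complementing the loop at \<open>v\<close> adds the unit vector of \<open>v\<close> to the \<open>v\<close>-column of \<open>A(G)\<close>,
  so it exchanges the columns of \<open>v\<close> in \<open>A(G)\<close> and \<open>I + A(G)\<close> and changes nothing else. Hence a graph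
  isomorphism matches the entries of the two representing matrices. Conversely, the \<open>Phi\<close>-elements
  form a basis preserved by \<open>\<beta>\<close>, and the entry of a further column in row \<open>u\<close> is read off the
  matroid: it is \<open>1\<close> iff exchanging the \<open>Phi\<close>-element of \<open>u\<close> for that column leaves an
  independent set. So \<open>\<beta>\<close> preserves matrix entries, and these determine adjacency.\<close>

section \<open>Independence of columns over GF(2)\<close>

lemma sum_fun_apply: "(\<Sum>x\<in>X. g x) i = (\<Sum>x\<in>X. g x i)"
  by (induction X rule: infinite_finite_induct) auto

text \<open>Coefficients in GF(2) are 0 or 1, so a linear combination is the sum over a subfamily.
  Taking subfamilies of indices also absorbs the injectivity condition: equal columns at distinct
  indices form a pair with sum zero.\<close>

lemma indep_column_matroid_iff:
  assumes "finite S"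
  shows "indep (column_matroid R C A) S \<longleftrightarrow>
    S \<subseteq> C \<and> (\<forall>T \<subseteq> S. (\<forall>i \<in> R. (\<Sum>j\<in>T. A i j) = 0) \<longrightarrow> T = {})"
proof -
  let ?c = "matrix_column R A"
  have "(\<Sum>j\<in>T. ?c j i) = (if i \<in> R then \<Sum>j\<in>T. A i j else 0)" for T i
    by (simp add: matrix_column_def)
  then have vanish: "(\<forall>i \<in> R. (\<Sum>j\<in>T. A i j) = 0) \<longleftrightarrow> (\<forall>i. (\<Sum>j\<in>T. ?c j i) = 0)" for T
    by auto
  have "inj_on ?c S \<and> gf2.independent (?c ` S) \<longleftrightarrow>
    (\<forall>T \<subseteq> S. (\<forall>i. (\<Sum>j\<in>T. ?c j i) = 0) \<longrightarrow> T = {})" (is "?L \<longleftrightarrow> ?R")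
  proof
    assume L: ?L
    show ?R
    proof (intro allI impI)
      fix T assume T: "T \<subseteq> S" "\<forall>i. (\<Sum>j\<in>T. ?c j i) = 0"
      have "inj_on ?c T" using L T inj_on_subset by blast
      then have zero: "(\<Sum>x\<in>?c ` T. gf2_scale 1 x) = 0"
        using T(2) by (simp add: sum.reindex fun_eq_iff sum_fun_apply)
      have fin: "finite (?c ` T)" using finite_subset[OF T(1) assms] by simp
      show "T = {}"
      proof (rule ccontr)
        assume "T \<noteq> {}"
        then have "\<exists>x \<in> ?c ` T. (1 :: bit) \<noteq> 0" by auto
        then have "gf2.dependent (?c ` T)"
          unfolding gf2.dependent_finite[OF fin] using zero by (intro exI[of _ "\<lambda>_. 1"] conjI)
        then have "gf2.dependent (?c ` S)" by (rule gf2.dependent_mono) (use T(1) in blast)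
        then show False using L by simp
      qed
    qed
  next
    assume R: ?R
    have inj: "inj_on ?c S"
    proof (rule inj_onI, rule ccontr)
      fix j k assume jk: "j \<in> S" "k \<in> S" "?c j = ?c k" "j \<noteq> k"
      then have "\<forall>i. (\<Sum>l\<in>{j, k}. ?c l i) = 0" by simp
      then show False using R[rule_format, of "{j, k}"] jk(1,2) by simp
    qed
    have "gf2.independent (?c ` S)"
    proof
      assume "gf2.dependent (?c ` S)"
      then obtain a where a: "\<exists>x\<in>?c ` S. a x \<noteq> 0" "(\<Sum>x\<in>?c ` S. gf2_scale (a x) x) = 0"
        using gf2.dependent_finite[of "?c ` S"] assms by auto
      \<comment> \<open>The support of the coefficients \<open>a\<close>, pulled back from column
        values to indices.\<close>
      let ?T = "{j \<in> S. a (?c j) = 1}"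
      have "(\<Sum>j\<in>?T. ?c j i) = 0" for i
      proof -
        have "(\<Sum>j\<in>?T. ?c j i) = (\<Sum>j\<in>S. a (?c j) * ?c j i)"
          using assms by (intro sum.mono_neutral_cong_left) auto
        also have "\<dots> = (\<Sum>x\<in>?c ` S. gf2_scale (a x) x) i"
          using inj by (simp add: sum.reindex sum_fun_apply gf2_scale_def)
        finally show ?thesis using a(2) by simp
      qed
      then have "?T = {}" using R[rule_format, of ?T] by simp
      then show False using a(1) by auto
    qed
    with inj show ?L ..
  qed
  then show ?thesis unfolding vanish column_matroid_def by simp
qed

text \<open>Relabelling rows by \<open>g\<close> and columns by \<open>\<beta>\<close> without
  changing entries preserves which column sums vanish, and these sums determine
  independence.\<close>

lemma matroid_isomorphism_column_matroid:
  assumes "finite C" and g: "bij_betw g R R'" and \<beta>: "bij_betw \<beta> C C'"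
    and entry: "\<And>i j. i \<in> R \<Longrightarrow> j \<in> C \<Longrightarrow> A' (g i) (\<beta> j) = A i j"
  shows "matroid_isomorphism (column_matroid R C A) (column_matroid R' C' A') \<beta>"
proof -
  have "indep (column_matroid R C A) S \<longleftrightarrow> indep (column_matroid R' C' A') (\<beta> ` S)"
    if S: "S \<subseteq> C" for S
  proof -
    have vanish: "(\<forall>i\<in>R'. (\<Sum>j\<in>\<beta> ` T. A' i j) = 0) \<longleftrightarrow> (\<forall>i\<in>R. (\<Sum>j\<in>T. A i j) = 0)"
      if "T \<subseteq> S" for T
    proof -
      have TC: "T \<subseteq> C" using that S by blast
      then have "inj_on \<beta> T" using \<beta> by (meson bij_betw_def inj_on_subset)
      then have "(\<Sum>j\<in>\<beta> ` T. A' (g i) j) = (\<Sum>j\<in>T. A i j)" if "i \<in> R" for i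
        using that TC entry by (auto simp: sum.reindex intro!: sum.cong)
      then show ?thesis using g by (auto simp: bij_betw_def)
    qed
    have "finite S" "\<beta> ` S \<subseteq> C'"
      using S \<open>finite C\<close> \<beta> finite_subset by (auto simp: bij_betw_def)
    then show ?thesis
      using S vanish by (simp add: indep_column_matroid_iff all_subset_image)
  qed
  then show ?thesis
    using \<beta> by (simp add: matroid_isomorphism_def column_matroid_def)
qed

section \<open>Reading matrix entries off the isotropic matroid\<close>

lemma UNIV_label: "UNIV = {Phi, Chi, Psi}"
  using label.exhaust by auto

lemma finite_UNIV_label: "finite (UNIV :: label set)"
  by (simp add: UNIV_label)

text \<open>The span of the unit vectors other than that of \<open>u\<close> consists of the vectors
  with entry 0 in row \<open>u\<close>. The condition on \<open>\<iota>\<close> keeps the new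
  element outside the remaining \<open>Phi\<close>-elements; otherwise the insertion could change
  nothing.\<close>

lemma indep_IAS_exchange_iff:
  assumes fin: "finite (verts G)" and u: "u \<in> verts G" and w: "w \<in> verts G" and "\<iota> \<noteq> Phi"
  shows "indep (IAS_matroid G) (insert (w, \<iota>) ((verts G - {u}) \<times> {Phi})) \<longleftrightarrow>
    IAS_matrix G u (w, \<iota>) = 1"
proof -
  let ?A = "IAS_matrix G" and ?B = "(verts G - {u}) \<times> {Phi}"
  let ?S = "insert (w, \<iota>) ?B"
  have sum_Phi: "(\<Sum>j\<in>X. ?A i j) = (if (i, Phi) \<in> X then 1 else 0)"
    if "X \<subseteq> ?B" for X i
  proof -
    have "finite X" using that fin by (meson finite.emptyI finite_Diff finite_SigmaI
          finite_insert finite_subset)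
    moreover have "(\<Sum>j\<in>X. ?A i j) = (\<Sum>j\<in>X. if j = (i, Phi) then 1 else 0)"
      using that by (intro sum.cong) (auto simp: IAS_matrix_def)
    ultimately show ?thesis by simp
  qed
  have *: "indep (IAS_matroid G) ?S \<longleftrightarrow>
    (\<forall>T \<subseteq> ?S. (\<forall>i \<in> verts G. (\<Sum>j\<in>T. ?A i j) = 0) \<longrightarrow> T = {})"
    using fin w by (auto simp: IAS_matroid_def indep_column_matroid_iff)
  show ?thesis
  proof
    assume ind: "indep (IAS_matroid G) ?S"
    show "?A u (w, \<iota>) = 1"
    proof (rule ccontr)
      assume "?A u (w, \<iota>) \<noteq> 1"
      then have 0: "?A u (w, \<iota>) = 0" by simp
      \<comment> \<open>The unit vectors in the expansion of the column \<open>(w, \<iota>)\<close>;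
        together with that column they sum to zero.\<close>
      let ?X = "{x \<in> verts G. ?A x (w, \<iota>) = 1} \<times> {Phi}"
      have X: "?X \<subseteq> ?B" "finite ?X" "(w, \<iota>) \<notin> ?X" using 0 fin \<open>\<iota> \<noteq> Phi\<close> by auto
      have "\<forall>i \<in> verts G. (\<Sum>j\<in>insert (w, \<iota>) ?X. ?A i j) = 0"
        using X by (auto simp: sum_Phi)
      then show False using ind X(1) unfolding * by blast
    qed
  next
    assume 1: "?A u (w, \<iota>) = 1"
    show "indep (IAS_matroid G) ?S"
      unfolding *
    proof (intro allI impI)
      fix T assume T: "T \<subseteq> ?S" and 0: "\<forall>i \<in> verts G. (\<Sum>j\<in>T. ?A i j) = 0"
      have "finite T" using T fin finite_subset by fastforce
      \<comment> \<open>In row \<open>u\<close> only \<open>(w, \<iota>)\<close> has a nonzero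
        entry, so nothing in \<open>T\<close> could cancel it.\<close>
      have "(w, \<iota>) \<notin> T"
      proof
        assume wT: "(w, \<iota>) \<in> T"
        have "(\<Sum>j\<in>T. ?A u j) = ?A u (w, \<iota>) + (\<Sum>j\<in>T - {(w, \<iota>)}. ?A u j)"
          by (rule sum.remove[OF \<open>finite T\<close> wT])
        moreover have "T - {(w, \<iota>)} \<subseteq> ?B" using T by auto
        then have "(\<Sum>j\<in>T - {(w, \<iota>)}. ?A u j) = 0" by (auto simp: sum_Phi)
        ultimately show False using 0 u 1 by simp
      qed
      then have TB: "T \<subseteq> ?B" using T by blast
      \<comment> \<open>Only unit vectors remain, and the sum in row \<open>i\<close> detects
        whether \<open>(i, Phi)\<close> is among them.\<close>
      then have "(i, Phi) \<notin> T" if "i \<in> verts G" for i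
        using 0 that sum_Phi[OF TB, of i] by auto
      then show "T = {}" using TB by fastforce
    qed
  qed
qed

text \<open>Since \<open>\<beta>\<close> carries \<open>Phi\<close>-elements to
  \<open>Phi\<close>-elements, it maps the exchange set for row \<open>u\<close> in \<open>G\<close>
  to the one for row \<open>induced_vertex \<beta> u\<close> in \<open>H\<close>, so both exchange
  tests agree.\<close>

lemma compatible_isomorphism_IAS_matrix:
  assumes \<beta>: "compatible_isomorphism G H \<beta>" and fin: "finite (verts G)"
    and Phi: "\<And>x. x \<in> verts G \<Longrightarrow> induced_perm \<beta> x Phi = Phi"
    and u: "u \<in> verts G" and w: "w \<in> verts G" and "\<iota> \<noteq> Phi"
  shows "IAS_matrix H (induced_vertex \<beta> u) (induced_vertex \<beta> w, induced_perm \<beta> w \<iota>) =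
    IAS_matrix G u (w, \<iota>)"
proof -
  let ?f = "induced_vertex \<beta>" and ?p = "induced_perm \<beta> w \<iota>"
  let ?S = "insert (w, \<iota>) ((verts G - {u}) \<times> {Phi})"
  note app = compatible_isomorphism_apply[OF \<beta>]
  have f: "bij_betw ?f (verts G) (verts H)" by (rule bij_betw_induced_vertex[OF \<beta>])
  then have im: "?f ` (verts G - {u}) = verts H - {?f u}"
    using u by (auto simp: bij_betw_def inj_on_def)
  have "\<beta> ` ((verts G - {u}) \<times> {Phi}) = (\<lambda>x. (x, Phi)) ` ?f ` (verts G - {u})"
    using app Phi by (force simp: image_iff)
  then have "\<beta> ` ?S = insert (?f w, ?p) ((verts H - {?f u}) \<times> {Phi})"
    using app[OF w] im by auto
  moreover have "?S \<subseteq> ground (IAS_matroid G)"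
    using w by (auto simp: IAS_matroid_def column_matroid_def)
  ultimately have "indep (IAS_matroid G) ?S \<longleftrightarrow>
      indep (IAS_matroid H) (insert (?f w, ?p) ((verts H - {?f u}) \<times> {Phi}))"
    using \<beta> by (metis compatible_isomorphism_def matroid_isomorphism_def)
  \<comment> \<open>The label \<open>Phi\<close> is already the image of \<open>Phi\<close>, so the
    exchange test also applies in \<open>H\<close>.\<close>
  moreover have "?p \<noteq> Phi"
    using bij_induced_perm[OF \<beta> w] Phi[OF w] \<open>\<iota> \<noteq> Phi\<close> by (metis bij_pointE)
  moreover have "finite (verts H)" "?f u \<in> verts H" "?f w \<in> verts H"
    using f fin u w bij_betw_finite bij_betwE by blast+
  ultimately have "IAS_matrix G u (w, \<iota>) = 1 \<longleftrightarrow> IAS_matrix H (?f u) (?f w, ?p) = 1"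
    using indep_IAS_exchange_iff fin u w \<open>\<iota> \<noteq> Phi\<close> by metis
  then show ?thesis by (cases "IAS_matrix G u (w, \<iota>) = 1") simp_all
qed

section \<open>Loop complementation and compatible isomorphisms\<close>

lemma UN_cell: "(\<Union>x\<in>X. cell x) = X \<times> UNIV"
  by (auto simp: cell_def)

lemma verts_complement_loop [simp]: "verts (complement_loop G v) = verts G"
  by (simp add: complement_loop_def)

text \<open>Adding 1 toggles a bit, so one formula covers both removing and inserting the
  loop.\<close>

lemma adj_matrix_complement_loop:
  "adj_matrix (complement_loop G v) u w = adj_matrix G u w + (if u = v \<and> w = v then 1 else 0)"
  by (auto simp: adj_matrix_def complement_loop_def doubleton_eq_iff)

lemma adj_matrix_eq_iff:
  "adj_matrix G u w = adj_matrix H x y \<longleftrightarrow> ({u, w} \<in> edges G \<longleftrightarrow> {x, y} \<in> edges H)"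
  by (simp add: adj_matrix_def)

theorem theorem8:
  fixes G1 :: "'a lgraph" and G2 :: "'b lgraph" and v :: 'a
  assumes "looped_simple_graph G1" and "looped_simple_graph G2" and "v \<in> verts G1"
  shows "graph_isomorphic (complement_loop G1 v) G2 \<longleftrightarrow>
    (\<exists>\<beta>. compatible_isomorphism G1 G2 \<beta> \<and>
         induced_perm \<beta> v = transpose Chi Psi \<and>
         (\<forall>w \<in> verts G1. w \<noteq> v \<longrightarrow> induced_perm \<beta> w = id))"
    (is "?L \<longleftrightarrow> ?R")
proof -
  have fin: "finite (verts G1)" using assms(1) by (simp add: looped_simple_graph_def)
  show ?thesis
  proof
    assume ?L
    then obtain f where f: "bij_betw f (verts G1) (verts G2)"
      and edges: "\<forall>u \<in> verts G1. \<forall>w \<in> verts G1.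
        {u, w} \<in> edges (complement_loop G1 v) \<longleftrightarrow> {f u, f w} \<in> edges G2"
      by (auto simp: graph_isomorphic_def)
    then have adj: "adj_matrix G2 (f u) (f w) =
        adj_matrix G1 u w + (if u = v \<and> w = v then 1 else 0)"
      if "u \<in> verts G1" "w \<in> verts G1" for u w
      using that by (metis adj_matrix_eq_iff adj_matrix_complement_loop)
    define p where "p = (\<lambda>w. if w = v then transpose Chi Psi else id)"
    define \<beta> where "\<beta> = (\<lambda>(w, \<iota>). (f w, p w \<iota>))"
    \<comment> \<open>Being an involution makes each \<open>p w\<close> a bijection of the
      labels.\<close>
    have p: "p w (p w \<iota>) = \<iota>" for w \<iota> by (simp add: p_def)
    have inj: "inj_on f (verts G1)" and im: "f ` verts G1 = verts G2"
      using f by (auto simp: bij_betw_def)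
    have cell: "\<beta> ` cell w = cell (f w)" for w
    proof -
      have "range (p w) = UNIV" using p by (metis surj_def)
      moreover have "\<beta> ` cell w = {f w} \<times> range (p w)" by (auto simp: \<beta>_def cell_def)
      ultimately show ?thesis by (simp add: cell_def)
    qed
    have "\<beta> ` (\<Union>w\<in>verts G1. cell w) = (\<Union>w\<in>f ` verts G1. cell w)"
      by (simp add: image_UN cell)
    then have "\<beta> ` (verts G1 \<times> UNIV) = verts G2 \<times> UNIV"
      by (simp add: im UN_cell)
    moreover have "inj_on \<beta> (verts G1 \<times> UNIV)"
    proof (rule inj_onI)
      fix j k assume jk: "j \<in> verts G1 \<times> UNIV" "k \<in> verts G1 \<times> UNIV" "\<beta> j = \<beta> k"
      then have "f (fst j) = f (fst k)" by (simp add: \<beta>_def case_prod_beta)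
      then have eq: "fst j = fst k" using jk by (simp add: inj_on_eq_iff[OF inj] mem_Times_iff)
      then have "p (fst k) (snd j) = p (fst k) (snd k)"
        using jk(3) by (simp add: \<beta>_def case_prod_beta)
      then have "snd j = snd k" using p by metis
      with eq show "j = k" by (simp add: prod_eq_iff)
    qed
    ultimately have "bij_betw \<beta> (verts G1 \<times> UNIV) (verts G2 \<times> UNIV)"
      by (simp add: bij_betw_def)
    \<comment> \<open>For the cell of \<open>v\<close>, the extra diagonal 1 turns the
      \<open>Chi\<close>-column into the \<open>Psi\<close>-column, and back because 1 + 1 = 0; this
      matches the swap in \<open>p\<close>.\<close>
    moreover have "IAS_matrix G2 (f i) (\<beta> j) = IAS_matrix G1 i j"
      if "i \<in> verts G1" "j \<in> verts G1 \<times> UNIV" for i j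
    proof -
      obtain w \<iota> where "j = (w, \<iota>)" "w \<in> verts G1" using \<open>j \<in> verts G1 \<times> UNIV\<close> by auto
      then show ?thesis
        using \<open>i \<in> verts G1\<close> inj
        by (cases \<iota>) (auto simp: IAS_matrix_def \<beta>_def p_def adj inj_on_eq_iff)
    qed
    ultimately have "matroid_isomorphism (IAS_matroid G1) (IAS_matroid G2) \<beta>"
      unfolding IAS_matroid_def using fin f finite_UNIV_label
      by (intro matroid_isomorphism_column_matroid[where g = f]) auto
    then have "compatible_isomorphism G1 G2 \<beta>"
      using cell im by (auto simp: compatible_isomorphism_def)
    moreover have "induced_perm \<beta> w = p w" for w
      by (simp add: induced_perm_def \<beta>_def)
    ultimately show ?R by (auto simp: p_def)
  next
    assume ?R
    then obtain \<beta> where \<beta>: "compatible_isomorphism G1 G2 \<beta>"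
      and v: "induced_perm \<beta> v = transpose Chi Psi"
      and id: "\<And>w. w \<in> verts G1 \<Longrightarrow> w \<noteq> v \<Longrightarrow> induced_perm \<beta> w = id"
      by blast
    let ?f = "induced_vertex \<beta>"
    have f: "bij_betw ?f (verts G1) (verts G2)" by (rule bij_betw_induced_vertex[OF \<beta>])
    \<comment> \<open>Both prescribed permutations fix \<open>Phi\<close>, as the comparison of
      entries requires.\<close>
    have Phi: "induced_perm \<beta> x Phi = Phi" if "x \<in> verts G1" for x
      using v id[OF that] by (cases "x = v") (auto simp: transpose_def)
    have "adj_matrix (complement_loop G1 v) u w = adj_matrix G2 (?f u) (?f w)"
      if uw: "u \<in> verts G1" "w \<in> verts G1" for u w
    proof -
      \<comment> \<open>The \<open>Chi\<close>-columns of \<open>G1\<close> suffice, as they form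
        its adjacency matrix. For \<open>w = v\<close> the image is a \<open>Psi\<close>-column of
        \<open>G2\<close>, whose identity part accounts for the toggled loop.\<close>
      have Chi: "IAS_matrix G2 (?f u) (?f w, induced_perm \<beta> w Chi) = IAS_matrix G1 u (w, Chi)"
        by (rule compatible_isomorphism_IAS_matrix[OF \<beta> fin Phi uw]) auto
      show ?thesis
      proof (cases "w = v")
        case True
        have "?f u = ?f v \<longleftrightarrow> u = v"
          using f uw assms(3) by (auto simp: bij_betw_def dest: inj_onD)
        then show ?thesis
          using Chi True
          by (auto simp: v IAS_matrix_def adj_matrix_complement_loop split: if_splits)
      next
        case False
        then show ?thesis
          using Chi by (simp add: id uw IAS_matrix_def adj_matrix_complement_loop)
      qed
    qed
    then show ?L
      unfolding graph_isomorphic_def adj_matrix_eq_iff using f by auto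
  qed
qed

end
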